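(* Let $\mathcal{D}=\langle A_0;S_0;T_0;\theta_0\rangle\Longrightarrow^{*}\langle\emptyset;S_n;T_n;\theta_n\rangle$ be an $\textsc{AUnif}$ derivation to a final configuration, and let $\sigma_{\mathcal{D}}=\sigma_{S_n\cup T_n}$ and $\rho_{\mathcal{D}}=\rho_{S_n\cup T_n}$. Then for every $s\triangleq_x t\in A_0\cup S_0\cup T_0$ we have $x\theta_n\in\mathcal{G}_{\mathtt{Abs}}(s,t)$, with $x\theta_n\sigma_{\mathcal{D}}\approx_{\mathtt{Abs}}s$ and $x\theta_n\rho_{\mathcal{D}}\approx_{\mathtt{Abs}}t$.
   Context: Terms are built over variables $\mathcal{V}$ and function symbols $\mathcal{F}$ containing a special constant $\star$ (wild card); $head(x)=x$, $head(f(t_1,\dots,t_n))=f$. Substitutions are postfix; $\mathit{Dom}(\sigma)=\{x\mid x\sigma\neq x\}$; $\mathit{Rvar}(\sigma)$ is the set of variables in its range. An absorption theory $\mathtt{Abs}$ is a finite union of axiom sets $\{f(x,\varepsilon_f)\approx\varepsilon_f, f(\varepsilon_f,x)\approx\varepsilon_f\}$ for pairwise distinct binary $f$; $f,\varepsilon_f$ are related absorption symbols; $\approx_{\mathtt{Abs}}$ is the induced equality. $r\preceq_{\mathtt{Abs}}s$ iff $r\sigma\approx_{\mathtt{Abs}}s$ for some $\sigma$; $\mathcal{G}_{\mathtt{Abs}}(s,t)=\{r\mid r\preceq_{\mathtt{Abs}}s,\ r\preceq_{\mathtt{Abs}}t\}$. A term is in $\mathtt{Abs}$-normal form if no $\varepsilon_f$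 occurs as an argument of $f$. An AUE is $s\triangleq_x t$ with label $x$; a set of AUEs is valid if labels are pairwise distinct; an AUE is wild if a side is $\star$; solved if $head(s)\neq head(t)$, they are not related absorption symbols, and it is not wild. A configuration $\langle A;S;T;\theta\rangle$: $A$ valid set of AUEs, $S$ valid set of solved AUEs, $T$ valid set of wild AUEs, $\theta$ a substitution, all terms in $\mathtt{Abs}$-normal form, $labels(A),labels(S),labels(T),\mathit{Dom}(\theta)$ pairwise disjoint, $\mathit{Rvar}(\theta)=labels(A)\cup labels(S)\cup labels(T)$. Rules of $\textsc{AUnif}$ ($\uplus$ disjoint union; $y_i$ fresh; $f$ in Exp rules an absorption symbol): (Dec) $\langle\{f(s_1,\dots,s_n)\triangleq_x f(t_1,\dots,t_n)\}\uplus A;S;T;\theta\rangle\Longrightarrow\langle\{s_i\triangleq_{y_i}t_i\}_{i=1}^n\cup A;S;T;\theta\{x\mapsto f(y_1,\dots,y_n)\}\rangle$, $n\ge0$. (Sol) $\langle\{s\triangleq_x t\}\uplus A;S;T;\theta\rangle\Longrightarrow\langle A;\{s\triangleq_x t\}\cup S;T;\theta\rangle$ if $head(s)\neq head(t)$ and they are not related absorption symbols. (ExpLA1) $\langle\{\varepsilon_f\triangleq_x f(t_1,t_2)\}\uplus A;S;T;\theta\rangle\Longrightarrow\langle\{\varepsilon_f\triangleq_{y_1}t_1\}\cup A;S;\{\star\triangleq_{y_2}t_2\}\cup T;\theta\{x\mapsto f(y_1,y_2)\}\rangle$. (ExpLA2) same left side $\Longrightarrow\langle\{\varepsilon_f\triangleq_{y_2}t_2\}\cup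 A;S;\{\star\triangleq_{y_1}t_1\}\cup T;\theta\{x\mapsto f(y_1,y_2)\}\rangle$. (ExpRA1) $\langle\{f(s_1,s_2)\triangleq_x\varepsilon_f\}\uplus A;S;T;\theta\rangle\Longrightarrow\langle\{s_1\triangleq_{y_1}\varepsilon_f\}\cup A;S;\{s_2\triangleq_{y_2}\star\}\cup T;\theta\{x\mapsto f(y_1,y_2)\}\rangle$. (ExpRA2) same left side $\Longrightarrow\langle\{s_2\triangleq_{y_2}\varepsilon_f\}\cup A;S;\{s_1\triangleq_{y_1}\star\}\cup T;\theta\{x\mapsto f(y_1,y_2)\}\rangle$. (Mer) $\langle\emptyset;\{s\triangleq_x t,s\triangleq_y t\}\cup S;T;\theta\rangle\Longrightarrow\langle\emptyset;\{s\triangleq_y t\}\cup S;T;\theta\{x\mapsto y\}\rangle$. A final configuration is one reached by a finite derivation to which no rule applies. For a valid set $W$ of AUEs, $\sigma_W=\{y\mapsto s\mid s\triangleq_y t\in W\}$ and $\rho_W=\{y\mapsto t\mid s\triangleq_y t\in W\}$. In the equalities, the wild card $\star$ is treated as an ordinary constant occurring under an absorption symbol next to $\varepsilon_f$ where it is absorbed. *)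

theory Defs
  imports Main
begin

section \<open>Terms and substitutions\<close>

datatype ('f, 'v) trm = Var 'v | Fun 'f "('f, 'v) trm list"

type_synonym ('f, 'v) subst = "'v \<Rightarrow> ('f, 'v) trm"

fun vars :: "('f, 'v) trm \<Rightarrow> 'v set" where
  "vars (Var x) = {x}"
| "vars (Fun f ts) = (\<Union>t\<in>set ts. vars t)"

text \<open>The symbols of the signature are the elements of the type \<open>'f\<close>, with arities given by \<open>ar\<close>;
  the terms over the signature are the arity-respecting elements of the datatype.\<close>

fun wf_trm :: "('f \<Rightarrow> nat) \<Rightarrow> ('f, 'v) trm \<Rightarrow> bool" where
  "wf_trm ar (Var x) \<longleftrightarrow> True"
| "wf_trm ar (Fun f ts) \<longleftrightarrow> length ts = ar f \<and> (\<forall>t\<in>set ts. wf_trm ar t)"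

primrec head :: "('f, 'v) trm \<Rightarrow> 'v + 'f" where
  "head (Var x) = Inl x"
| "head (Fun f ts) = Inr f"

primrec subst_apply :: "('f, 'v) trm \<Rightarrow> ('f, 'v) subst \<Rightarrow> ('f, 'v) trm" (infixl "\<cdot>" 67) where
  "Var x \<cdot> \<sigma> = \<sigma> x"
| "Fun f ts \<cdot> \<sigma> = Fun f (map (\<lambda>t. t \<cdot> \<sigma>) ts)"

text \<open>Composition in postfix order: first \<open>\<sigma>\<close>, then \<open>\<tau>\<close>.\<close>

definition subst_comp :: "('f, 'v) subst \<Rightarrow> ('f, 'v) subst \<Rightarrow> ('f, 'v) subst" (infixl "\<circ>\<^sub>s" 75) where
  "\<sigma> \<circ>\<^sub>s \<tau> = (\<lambda>x. \<sigma> x \<cdot> \<tau>)"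

definition Dom :: "('f, 'v) subst \<Rightarrow> 'v set" where
  "Dom \<sigma> = {x. \<sigma> x \<noteq> Var x}"

definition Rvar :: "('f, 'v) subst \<Rightarrow> 'v set" where
  "Rvar \<sigma> = (\<Union>x\<in>Dom \<sigma>. vars (\<sigma> x))"

text \<open>Finiteness of the domain is not required; for the generalization preorder below this makes
  no difference (lemma \<open>more_general_finite_Dom\<close>).\<close>

definition wf_subst :: "('f \<Rightarrow> nat) \<Rightarrow> ('f, 'v) subst \<Rightarrow> bool" where
  "wf_subst ar \<sigma> \<longleftrightarrow> (\<forall>x. wf_trm ar (\<sigma> x))"


section \<open>Equational theories and absorption\<close>

inductive eq_theory ::
  "('f \<Rightarrow> nat) \<Rightarrow> (('f, 'v) trm \<times> ('f, 'v) trm) set \<Rightarrow> ('f, 'v) trm \<Rightarrow> ('f, 'v) trm \<Rightarrow> bool"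
  for ar E where
  ax: "(l, r) \<in> E \<Longrightarrow> wf_subst ar \<sigma> \<Longrightarrow> eq_theory ar E (l \<cdot> \<sigma>) (r \<cdot> \<sigma>)"
| refl: "wf_trm ar t \<Longrightarrow> eq_theory ar E t t"
| sym: "eq_theory ar E s t \<Longrightarrow> eq_theory ar E t s"
| trans: "eq_theory ar E s t \<Longrightarrow> eq_theory ar E t u \<Longrightarrow> eq_theory ar E s u"
| cong: "list_all2 (eq_theory ar E) ss ts \<Longrightarrow> length ss = ar f \<Longrightarrow>
    eq_theory ar E (Fun f ss) (Fun f ts)"

text \<open>An absorption theory is given by a finite partial map \<open>ab\<close> with \<open>ab f = Some e\<close> iff \<open>f\<close> is
  an absorption symbol with \<open>\<epsilon>\<^sub>f = e\<close>.\<close>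

definition absorption_theory :: "('f \<Rightarrow> nat) \<Rightarrow> ('f \<rightharpoonup> 'f) \<Rightarrow> bool" where
  "absorption_theory ar ab \<longleftrightarrow>
     finite (dom ab) \<and> (\<forall>f e. ab f = Some e \<longrightarrow> ar f = 2 \<and> ar e = 0)"

definition Abs_axioms :: "('f \<rightharpoonup> 'f) \<Rightarrow> (('f, 'v) trm \<times> ('f, 'v) trm) set" where
  "Abs_axioms ab =
     {(Fun f [Var x, Fun e []], Fun e []) | f e x. ab f = Some e} \<union>
     {(Fun f [Fun e [], Var x], Fun e []) | f e x. ab f = Some e}"

definition abs_eq ::
  "('f \<Rightarrow> nat) \<Rightarrow> ('f \<rightharpoonup> 'f) \<Rightarrow> ('f, 'v) trm \<Rightarrow> ('f, 'v) trm \<Rightarrow> bool" where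
  "abs_eq ar ab = eq_theory ar (Abs_axioms ab)"

definition related :: "('f \<rightharpoonup> 'f) \<Rightarrow> 'v + 'f \<Rightarrow> 'v + 'f \<Rightarrow> bool" where
  "related ab h k \<longleftrightarrow>
     (\<exists>f e. ab f = Some e \<and> (h = Inr f \<and> k = Inr e \<or> h = Inr e \<and> k = Inr f))"

fun abs_nf :: "('f \<rightharpoonup> 'f) \<Rightarrow> ('f, 'v) trm \<Rightarrow> bool" where
  "abs_nf ab (Var x) \<longleftrightarrow> True"
| "abs_nf ab (Fun f ts) \<longleftrightarrow>
     (\<forall>e. ab f = Some e \<longrightarrow> Fun e [] \<notin> set ts) \<and> (\<forall>t\<in>set ts. abs_nf ab t)"

definition more_general ::
  "('f \<Rightarrow> nat) \<Rightarrow> ('f \<rightharpoonup> 'f) \<Rightarrow> ('f, 'v) trm \<Rightarrow> ('f, 'v) trm \<Rightarrow> bool" where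
  "more_general ar ab r s \<longleftrightarrow> (\<exists>\<sigma>. wf_subst ar \<sigma> \<and> abs_eq ar ab (r \<cdot> \<sigma>) s)"

definition generalizations ::
  "('f \<Rightarrow> nat) \<Rightarrow> ('f \<rightharpoonup> 'f) \<Rightarrow> ('f, 'v) trm \<Rightarrow> ('f, 'v) trm \<Rightarrow> ('f, 'v) trm set" where
  "generalizations ar ab s t =
     {r. wf_trm ar r \<and> more_general ar ab r s \<and> more_general ar ab r t}"

lemma finite_vars: "finite (vars t)"
  by (induction t) auto

lemma subst_apply_cong: "(\<And>x. x \<in> vars t \<Longrightarrow> \<sigma> x = \<tau> x) \<Longrightarrow> t \<cdot> \<sigma> = t \<cdot> \<tau>"
  by (induction t) auto

lemma more_general_finite_Dom:
  "more_general ar ab r s \<longleftrightarrow>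
     (\<exists>\<sigma>. wf_subst ar \<sigma> \<and> finite (Dom \<sigma>) \<and> abs_eq ar ab (r \<cdot> \<sigma>) s)"
proof
  assume "more_general ar ab r s"
  then obtain \<sigma> where \<sigma>: "wf_subst ar \<sigma>" "abs_eq ar ab (r \<cdot> \<sigma>) s"
    by (auto simp: more_general_def)
  define \<tau> where "\<tau> = (\<lambda>x. if x \<in> vars r then \<sigma> x else Var x)"
  have "r \<cdot> \<tau> = r \<cdot> \<sigma>"
    by (rule subst_apply_cong) (simp add: \<tau>_def)
  moreover have "wf_subst ar \<tau>"
    using \<sigma>(1) by (simp add: wf_subst_def \<tau>_def)
  moreover have "Dom \<tau> \<subseteq> vars r"
    by (auto simp: Dom_def \<tau>_def)
  then have "finite (Dom \<tau>)"
    using finite_vars finite_subset by blast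
  ultimately show "\<exists>\<sigma>. wf_subst ar \<sigma> \<and> finite (Dom \<sigma>) \<and> abs_eq ar ab (r \<cdot> \<sigma>) s"
    using \<sigma>(2) by metis
qed (auto simp: more_general_def)


section \<open>Anti-unification equations and configurations\<close>

datatype ('f, 'v) aue =
  AUE (lhs: "('f, 'v) trm") (label: 'v) (rhs: "('f, 'v) trm")  ("_ \<triangleq>\<^bsub>_\<^esub> _" [61, 0, 61] 60)

abbreviation labels :: "('f, 'v) aue set \<Rightarrow> 'v set" where
  "labels W \<equiv> label ` W"

definition valid :: "('f, 'v) aue set \<Rightarrow> bool" where
  "valid W \<longleftrightarrow> inj_on label W"

definition wild :: "'f \<Rightarrow> ('f, 'v) aue \<Rightarrow> bool" where
  "wild star u \<longleftrightarrow> lhs u = Fun star [] \<or> rhs u = Fun star []"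

definition solved :: "('f \<rightharpoonup> 'f) \<Rightarrow> 'f \<Rightarrow> ('f, 'v) aue \<Rightarrow> bool" where
  "solved ab star u \<longleftrightarrow>
     head (lhs u) \<noteq> head (rhs u) \<and> \<not> related ab (head (lhs u)) (head (rhs u)) \<and> \<not> wild star u"

type_synonym ('f, 'v) config =
  "('f, 'v) aue set \<times> ('f, 'v) aue set \<times> ('f, 'v) aue set \<times> ('f, 'v) subst"

fun configuration :: "('f \<Rightarrow> nat) \<Rightarrow> ('f \<rightharpoonup> 'f) \<Rightarrow> 'f \<Rightarrow> ('f, 'v) config \<Rightarrow> bool" where
  "configuration ar ab star (A, S, T, \<theta>) \<longleftrightarrow>
     valid A \<and>
     valid S \<and> (\<forall>u\<in>S. solved ab star u) \<and>
     valid T \<and> (\<forall>u\<in>T. wild star u) \<and>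
     (\<forall>u\<in>A \<union> S \<union> T. wf_trm ar (lhs u) \<and> wf_trm ar (rhs u) \<and>
        abs_nf ab (lhs u) \<and> abs_nf ab (rhs u)) \<and>
     wf_subst ar \<theta> \<and> (\<forall>x. abs_nf ab (\<theta> x)) \<and>
     labels A \<inter> labels S = {} \<and> labels A \<inter> labels T = {} \<and> labels S \<inter> labels T = {} \<and>
     labels A \<inter> Dom \<theta> = {} \<and> labels S \<inter> Dom \<theta> = {} \<and> labels T \<inter> Dom \<theta> = {} \<and>
     Rvar \<theta> = labels A \<union> labels S \<union> labels T"

fun config_vars :: "('f, 'v) config \<Rightarrow> 'v set" where
  "config_vars (A, S, T, \<theta>) =
     labels (A \<union> S \<union> T) \<union> (\<Union>u\<in>A \<union> S \<union> T. vars (lhs u) \<union> vars (rhs u)) \<union> Dom \<theta> \<union> Rvar \<theta>"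

definition fresh :: "'v list \<Rightarrow> ('f, 'v) config \<Rightarrow> bool" where
  "fresh ys c \<longleftrightarrow> distinct ys \<and> set ys \<inter> config_vars c = {}"


section \<open>The rules\<close>

text \<open>A disjoint union \<open>{u} \<uplus> A\<close> on the left of a rule is rendered as \<open>insert u A\<close> with \<open>u \<notin> A\<close>.\<close>

inductive step :: "('f \<rightharpoonup> 'f) \<Rightarrow> 'f \<Rightarrow> ('f, 'v) config \<Rightarrow> ('f, 'v) config \<Rightarrow> bool"
  for ab star where
  Dec: "\<lbrakk> (Fun f ss \<triangleq>\<^bsub>x\<^esub> Fun f ts) \<notin> A; length ss = n; length ts = n; length ys = n;
      fresh ys (insert (Fun f ss \<triangleq>\<^bsub>x\<^esub> Fun f ts) A, S, T, \<theta>) \<rbrakk> \<Longrightarrow>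
    step ab star (insert (Fun f ss \<triangleq>\<^bsub>x\<^esub> Fun f ts) A, S, T, \<theta>)
      ({(ss ! i \<triangleq>\<^bsub>ys ! i\<^esub> ts ! i) | i. i < n} \<union> A, S, T, \<theta> \<circ>\<^sub>s Var(x := Fun f (map Var ys)))"
| Sol: "\<lbrakk> (s \<triangleq>\<^bsub>x\<^esub> t) \<notin> A; head s \<noteq> head t; \<not> related ab (head s) (head t) \<rbrakk> \<Longrightarrow>
    step ab star (insert (s \<triangleq>\<^bsub>x\<^esub> t) A, S, T, \<theta>) (A, insert (s \<triangleq>\<^bsub>x\<^esub> t) S, T, \<theta>)"
| ExpLA1: "\<lbrakk> (Fun e [] \<triangleq>\<^bsub>x\<^esub> Fun f [t1, t2]) \<notin> A; ab f = Some e;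
      fresh [y1, y2] (insert (Fun e [] \<triangleq>\<^bsub>x\<^esub> Fun f [t1, t2]) A, S, T, \<theta>) \<rbrakk> \<Longrightarrow>
    step ab star (insert (Fun e [] \<triangleq>\<^bsub>x\<^esub> Fun f [t1, t2]) A, S, T, \<theta>)
      (insert (Fun e [] \<triangleq>\<^bsub>y1\<^esub> t1) A, S, insert (Fun star [] \<triangleq>\<^bsub>y2\<^esub> t2) T,
       \<theta> \<circ>\<^sub>s Var(x := Fun f [Var y1, Var y2]))"
| ExpLA2: "\<lbrakk> (Fun e [] \<triangleq>\<^bsub>x\<^esub> Fun f [t1, t2]) \<notin> A; ab f = Some e;
      fresh [y1, y2] (insert (Fun e [] \<triangleq>\<^bsub>x\<^esub> Fun f [t1, t2]) A, S, T, \<theta>) \<rbrakk> \<Longrightarrow>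
    step ab star (insert (Fun e [] \<triangleq>\<^bsub>x\<^esub> Fun f [t1, t2]) A, S, T, \<theta>)
      (insert (Fun e [] \<triangleq>\<^bsub>y2\<^esub> t2) A, S, insert (Fun star [] \<triangleq>\<^bsub>y1\<^esub> t1) T,
       \<theta> \<circ>\<^sub>s Var(x := Fun f [Var y1, Var y2]))"
| ExpRA1: "\<lbrakk> (Fun f [s1, s2] \<triangleq>\<^bsub>x\<^esub> Fun e []) \<notin> A; ab f = Some e;
      fresh [y1, y2] (insert (Fun f [s1, s2] \<triangleq>\<^bsub>x\<^esub> Fun e []) A, S, T, \<theta>) \<rbrakk> \<Longrightarrow>
    step ab star (insert (Fun f [s1, s2] \<triangleq>\<^bsub>x\<^esub> Fun e []) A, S, T, \<theta>)
      (insert (s1 \<triangleq>\<^bsub>y1\<^esub> Fun e []) A, S, insert (s2 \<triangleq>\<^bsub>y2\<^esub> Fun star []) T,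
       \<theta> \<circ>\<^sub>s Var(x := Fun f [Var y1, Var y2]))"
| ExpRA2: "\<lbrakk> (Fun f [s1, s2] \<triangleq>\<^bsub>x\<^esub> Fun e []) \<notin> A; ab f = Some e;
      fresh [y1, y2] (insert (Fun f [s1, s2] \<triangleq>\<^bsub>x\<^esub> Fun e []) A, S, T, \<theta>) \<rbrakk> \<Longrightarrow>
    step ab star (insert (Fun f [s1, s2] \<triangleq>\<^bsub>x\<^esub> Fun e []) A, S, T, \<theta>)
      (insert (s2 \<triangleq>\<^bsub>y2\<^esub> Fun e []) A, S, insert (s1 \<triangleq>\<^bsub>y1\<^esub> Fun star []) T,
       \<theta> \<circ>\<^sub>s Var(x := Fun f [Var y1, Var y2]))"
| Mer: "\<lbrakk> x \<noteq> y; (s \<triangleq>\<^bsub>x\<^esub> t) \<notin> S; (s \<triangleq>\<^bsub>y\<^esub> t) \<notin> S \<rbrakk> \<Longrightarrow>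
    step ab star ({}, {s \<triangleq>\<^bsub>x\<^esub> t, s \<triangleq>\<^bsub>y\<^esub> t} \<union> S, T, \<theta>)
      ({}, {s \<triangleq>\<^bsub>y\<^esub> t} \<union> S, T, \<theta> \<circ>\<^sub>s Var(x := Var y))"

definition derivation ::
  "('f \<Rightarrow> nat) \<Rightarrow> ('f \<rightharpoonup> 'f) \<Rightarrow> 'f \<Rightarrow> ('f, 'v) config \<Rightarrow> ('f, 'v) config \<Rightarrow> bool" where
  "derivation ar ab star c c' \<longleftrightarrow> configuration ar ab star c \<and> (step ab star)\<^sup>*\<^sup>* c c'"

definition final :: "('f \<rightharpoonup> 'f) \<Rightarrow> 'f \<Rightarrow> ('f, 'v) config \<Rightarrow> bool" where
  "final ab star c \<longleftrightarrow> (\<nexists>c'. step ab star c c')"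

text \<open>The next two definitions are meaningful for valid \<open>W\<close>, where the equation with label \<open>y\<close> is
  unique.\<close>

definition lhs_subst :: "('f, 'v) aue set \<Rightarrow> ('f, 'v) subst" where
  "lhs_subst W = (\<lambda>y. if y \<in> labels W then lhs (THE u. u \<in> W \<and> label u = y) else Var y)"

definition rhs_subst :: "('f, 'v) aue set \<Rightarrow> ('f, 'v) subst" where
  "rhs_subst W = (\<lambda>y. if y \<in> labels W then rhs (THE u. u \<in> W \<and> label u = y) else Var y)"

end

theory Submission
  imports Defs
begin

text \<open>Say that \<open>\<sigma>\<close> and \<open>\<rho>\<close> solve a set of equations if \<open>x\<sigma> \<approx> s\<close> and \<open>x\<rho> \<approx> t\<close> for each of its
  members \<open>s \<triangleq>\<^bsub>x\<^esub> t\<close>. Every rule composes the substitution with some \<open>\<delta>\<close> such that \<open>\<delta>\<sigma>\<close> and \<open>\<delta>\<rho>\<close> solve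
  the old equations whenever \<open>\<sigma>\<close> and \<open>\<rho>\<close> solve the new ones; only the expansion rules need the
  axioms, through \<open>f(\<epsilon>\<^sub>f, \<star>) \<approx> \<epsilon>\<^sub>f\<close>. The two substitutions read off from the last configuration solve its
  equations, so pulling them back along the derivation solves the initial ones. Reasoning backwards
  in this way requires nothing of the variables of \<open>\<theta>\<close>, only that labels stay distinct.\<close>

section \<open>Substitutions and equality modulo absorption\<close>

lemma subst_apply_subst_apply: "t \<cdot> \<sigma> \<cdot> \<tau> = t \<cdot> (\<sigma> \<circ>\<^sub>s \<tau>)"
  by (induction t) (auto simp: subst_comp_def)

lemma subst_apply_Var: "t \<cdot> Var = t"
  by (induction t) (auto simp: map_idI)

lemma subst_comp_assoc: "\<sigma> \<circ>\<^sub>s \<tau> \<circ>\<^sub>s \<upsilon> = \<sigma> \<circ>\<^sub>s (\<tau> \<circ>\<^sub>s \<upsilon>)"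
  by (simp add: subst_comp_def subst_apply_subst_apply)

lemma subst_comp_Var: "\<sigma> \<circ>\<^sub>s Var = \<sigma>"
  by (simp add: subst_comp_def subst_apply_Var)

lemma Var_subst_comp: "Var \<circ>\<^sub>s \<sigma> = \<sigma>"
  by (simp add: subst_comp_def)

lemma wf_trm_subst_apply: "wf_trm ar t \<Longrightarrow> wf_subst ar \<sigma> \<Longrightarrow> wf_trm ar (t \<cdot> \<sigma>)"
  by (induction t) (auto simp: wf_subst_def)

lemma wf_subst_comp: "wf_subst ar \<sigma> \<Longrightarrow> wf_subst ar \<tau> \<Longrightarrow> wf_subst ar (\<sigma> \<circ>\<^sub>s \<tau>)"
  by (metis subst_comp_def wf_subst_def wf_trm_subst_apply)

lemma wf_subst_Var_upd: "wf_trm ar r \<Longrightarrow> wf_subst ar (Var(x := r))"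
  by (simp add: wf_subst_def)

lemma absorption_theory_arity:
  assumes "absorption_theory ar ab" and "ab f = Some e"
  shows "ar f = 2" and "ar e = 0"
  using assms by (auto simp: absorption_theory_def)

lemma abs_eq_refl: "wf_trm ar t \<Longrightarrow> abs_eq ar ab t t"
  unfolding abs_eq_def by (rule eq_theory.refl)

lemma abs_eq_trans: "abs_eq ar ab s t \<Longrightarrow> abs_eq ar ab t u \<Longrightarrow> abs_eq ar ab s u"
  unfolding abs_eq_def by (rule eq_theory.trans)

lemma abs_eq_cong:
  "list_all2 (abs_eq ar ab) ss ts \<Longrightarrow> length ss = ar f \<Longrightarrow> abs_eq ar ab (Fun f ss) (Fun f ts)"
  unfolding abs_eq_def by (rule eq_theory.cong)

lemma abs_eq_axiom:
  "(l, r) \<in> Abs_axioms ab \<Longrightarrow> wf_subst ar \<sigma> \<Longrightarrow> abs_eq ar ab (l \<cdot> \<sigma>) (r \<cdot> \<sigma>)"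
  unfolding abs_eq_def by (rule eq_theory.ax)

lemma
  assumes "ab f = Some e" and "wf_trm ar t"
  shows abs_eq_absorb_left: "abs_eq ar ab (Fun f [Fun e [], t]) (Fun e [])"
    and abs_eq_absorb_right: "abs_eq ar ab (Fun f [t, Fun e []]) (Fun e [])"
proof -
  have "(Fun f [Fun e [], Var x], Fun e []) \<in> Abs_axioms ab"
    "(Fun f [Var x, Fun e []], Fun e []) \<in> Abs_axioms ab" for x
    using assms(1) by (auto simp: Abs_axioms_def)
  from this[THEN abs_eq_axiom, of ar "\<lambda>_. t"]
  show "abs_eq ar ab (Fun f [Fun e [], t]) (Fun e [])"
    "abs_eq ar ab (Fun f [t, Fun e []]) (Fun e [])"
    using assms(2) by (simp_all add: wf_subst_def)
qed

lemma generalizationsI: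
  assumes "wf_trm ar r" and "wf_subst ar \<sigma>" and "abs_eq ar ab (r \<cdot> \<sigma>) s"
    and "wf_subst ar \<rho>" and "abs_eq ar ab (r \<cdot> \<rho>) t"
  shows "r \<in> generalizations ar ab s t"
  using assms by (auto simp: generalizations_def more_general_def)


section \<open>Well-formed configurations\<close>

definition wf_aues :: "('f \<Rightarrow> nat) \<Rightarrow> ('f, 'v) aue set \<Rightarrow> bool" where
  "wf_aues ar W \<longleftrightarrow> valid W \<and> (\<forall>u\<in>W. wf_trm ar (lhs u) \<and> wf_trm ar (rhs u))"

lemma wf_aues_insert:
  "wf_aues ar (insert u W) \<longleftrightarrow>
     wf_trm ar (lhs u) \<and> wf_trm ar (rhs u) \<and> label u \<notin> labels (W - {u}) \<and> wf_aues ar W"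
  by (auto simp: wf_aues_def valid_def)

lemma wf_aues_Un:
  assumes "labels V \<inter> labels W = {}"
  shows "wf_aues ar (V \<union> W) \<longleftrightarrow> wf_aues ar V \<and> wf_aues ar W"
  using assms unfolding wf_aues_def valid_def inj_on_Un by blast

lemma wf_aues_subset: "wf_aues ar W \<Longrightarrow> V \<subseteq> W \<Longrightarrow> wf_aues ar V"
  by (auto simp: wf_aues_def valid_def intro: inj_on_subset)

definition arg_aues ::
  "('f, 'v) trm list \<Rightarrow> 'v list \<Rightarrow> ('f, 'v) trm list \<Rightarrow> ('f, 'v) aue set" where
  "arg_aues ss ys ts = {(ss ! i \<triangleq>\<^bsub>ys ! i\<^esub> ts ! i) | i. i < length ys}"

lemma labels_arg_aues: "labels (arg_aues ss ys ts) = set ys"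
  by (force simp: arg_aues_def set_conv_nth)

lemma arg_aues_pair: "arg_aues [s1, s2] [y1, y2] [t1, t2] = {s1 \<triangleq>\<^bsub>y1\<^esub> t1, s2 \<triangleq>\<^bsub>y2\<^esub> t2}"
  by (auto simp: arg_aues_def less_Suc_eq exI[of _ "0::nat"] exI[of _ "Suc 0"])

lemma wf_arg_aues:
  assumes "distinct ys" and "length ss = length ys" and "length ts = length ys"
    and "\<forall>t\<in>set ss \<union> set ts. wf_trm ar t"
  shows "wf_aues ar (arg_aues ss ys ts)"
  using assms by (auto simp: arg_aues_def wf_aues_def valid_def inj_on_def nth_eq_iff_index_eq)

lemma
  assumes "valid W" and "u \<in> W"
  shows lhs_subst_label: "lhs_subst W (label u) = lhs u"
    and rhs_subst_label: "rhs_subst W (label u) = rhs u"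
proof -
  have "(THE v. v \<in> W \<and> label v = label u) = u"
    using assms by (intro the_equality) (auto simp: valid_def inj_on_def)
  then show "lhs_subst W (label u) = lhs u" "rhs_subst W (label u) = rhs u"
    using assms(2) by (simp_all add: lhs_subst_def rhs_subst_def)
qed

lemma
  assumes "wf_aues ar W"
  shows wf_lhs_subst: "wf_subst ar (lhs_subst W)"
    and wf_rhs_subst: "wf_subst ar (rhs_subst W)"
proof -
  have "wf_trm ar (lhs_subst W x) \<and> wf_trm ar (rhs_subst W x)" for x
  proof (cases "x \<in> labels W")
    case True
    then show ?thesis
      using assms by (auto simp: wf_aues_def lhs_subst_label rhs_subst_label)
  next
    case False
    then show ?thesis
      by (simp add: lhs_subst_def rhs_subst_def)
  qed
  then show "wf_subst ar (lhs_subst W)" "wf_subst ar (rhs_subst W)"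
    by (simp_all add: wf_subst_def)
qed

fun aues :: "('f, 'v) config \<Rightarrow> ('f, 'v) aue set" where
  "aues (A, S, T, \<theta>) = A \<union> S \<union> T"

fun config_subst :: "('f, 'v) config \<Rightarrow> ('f, 'v) subst" where
  "config_subst (A, S, T, \<theta>) = \<theta>"

text \<open>The predicate \<^const>\<open>configuration\<close> itself is not an invariant: \<open>Sol\<close> may move a wild equation
  into \<open>S\<close>.\<close>

fun wf_config :: "('f \<Rightarrow> nat) \<Rightarrow> ('f, 'v) config \<Rightarrow> bool" where
  "wf_config ar (A, S, T, \<theta>) \<longleftrightarrow>
     wf_aues ar A \<and> wf_aues ar S \<and> wf_aues ar T \<and> wf_subst ar \<theta> \<and>
     labels A \<inter> labels S = {} \<and> labels A \<inter> labels T = {} \<and> labels S \<inter> labels T = {}"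

lemma configuration_imp_wf_config: "configuration ar ab star c \<Longrightarrow> wf_config ar c"
  by (cases c) (auto simp: wf_aues_def)

lemma configuration_subst_label:
  assumes "configuration ar ab star c" and "u \<in> aues c"
  shows "config_subst c (label u) = Var (label u)"
proof -
  have "labels (aues c) \<inter> Dom (config_subst c) = {}"
    using assms(1) by (cases c) (simp add: image_Un Int_Un_distrib2)
  with assms(2) show ?thesis
    by (auto simp: Dom_def)
qed

lemma wf_config_imp_wf_aues: "wf_config ar c \<Longrightarrow> wf_aues ar (aues c)"
  by (cases c) (auto simp: wf_aues_Un image_Un Int_Un_distrib2)

lemma wf_config_label_notin:
  assumes "wf_config ar (insert u A, S, T, \<theta>)" and "u \<notin> A"
  shows "label u \<notin> labels (A \<union> S \<union> T)"
  using assms by (auto simp: wf_aues_insert image_Un)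

lemma fresh_labels:
  assumes "fresh ys c"
  shows "distinct ys" and "set ys \<inter> labels (aues c) = {}"
  using assms by (cases c; simp add: fresh_def Int_Un_distrib)+


section \<open>The shapes of the rules\<close>

text \<open>An expansion rule has the shape of \<open>Dec\<close> if the side \<open>\<epsilon>\<^sub>f\<close> is read as \<open>f(\<epsilon>\<^sub>f, \<star>)\<close> or
  \<open>f(\<star>, \<epsilon>\<^sub>f)\<close>.\<close>

inductive expands :: "('f \<Rightarrow> nat) \<Rightarrow> ('f \<rightharpoonup> 'f) \<Rightarrow> ('f, 'v) config \<Rightarrow> ('f, 'v) config \<Rightarrow> bool"
  for ar ab where
  expand: "\<lbrakk> (s \<triangleq>\<^bsub>x\<^esub> t) \<notin> A; fresh ys (insert (s \<triangleq>\<^bsub>x\<^esub> t) A, S, T, \<theta>); length ys = ar f;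
      wf_trm ar (Fun f ss); wf_trm ar (Fun f ts);
      abs_eq ar ab (Fun f ss) s; abs_eq ar ab (Fun f ts) t;
      N \<union> M = arg_aues ss ys ts; N \<inter> M = {} \<rbrakk> \<Longrightarrow>
    expands ar ab (insert (s \<triangleq>\<^bsub>x\<^esub> t) A, S, T, \<theta>)
      (N \<union> A, S, M \<union> T, \<theta> \<circ>\<^sub>s Var(x := Fun f (map Var ys)))"

lemma
  assumes "(s \<triangleq>\<^bsub>x\<^esub> t) \<notin> A" and "fresh [y1, y2] (insert (s \<triangleq>\<^bsub>x\<^esub> t) A, S, T, \<theta>)"
    and "wf_trm ar (Fun f [s1, s2])" and "wf_trm ar (Fun f [t1, t2])"
    and "abs_eq ar ab (Fun f [s1, s2]) s" and "abs_eq ar ab (Fun f [t1, t2]) t"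
  shows expands_first: "expands ar ab (insert (s \<triangleq>\<^bsub>x\<^esub> t) A, S, T, \<theta>)
      (insert (s1 \<triangleq>\<^bsub>y1\<^esub> t1) A, S, insert (s2 \<triangleq>\<^bsub>y2\<^esub> t2) T,
       \<theta> \<circ>\<^sub>s Var(x := Fun f [Var y1, Var y2]))" (is ?first)
    and expands_second: "expands ar ab (insert (s \<triangleq>\<^bsub>x\<^esub> t) A, S, T, \<theta>)
      (insert (s2 \<triangleq>\<^bsub>y2\<^esub> t2) A, S, insert (s1 \<triangleq>\<^bsub>y1\<^esub> t1) T,
       \<theta> \<circ>\<^sub>s Var(x := Fun f [Var y1, Var y2]))" (is ?second)
proof -
  have "y1 \<noteq> y2" and "length [y1, y2] = ar f"
    using fresh_labels(1)[OF assms(2)] assms(3) by auto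
  then show ?first ?second
    using expands.expand[OF assms(1,2) _ assms(3-6),
        of "{s1 \<triangleq>\<^bsub>y1\<^esub> t1}" "{s2 \<triangleq>\<^bsub>y2\<^esub> t2}"]
      expands.expand[OF assms(1,2) _ assms(3-6),
        of "{s2 \<triangleq>\<^bsub>y2\<^esub> t2}" "{s1 \<triangleq>\<^bsub>y1\<^esub> t1}"]
    by (auto simp: arg_aues_pair)
qed

lemma step_cases:
  assumes "absorption_theory ar ab" and "ar star = 0"
    and "step ab star c c'" and wf: "wf_config ar c"
  obtains
    (expand) "expands ar ab c c'"
  | (solve) u A S T \<theta> where "c = (insert u A, S, T, \<theta>)" "u \<notin> A" "c' = (A, insert u S, T, \<theta>)"
  | (merge) s x t y S T \<theta> where "c = ({}, insert (s \<triangleq>\<^bsub>x\<^esub> t) S, T, \<theta>)" "(s \<triangleq>\<^bsub>x\<^esub> t) \<notin> S"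
      "(s \<triangleq>\<^bsub>y\<^esub> t) \<in> S" "c' = ({}, S, T, \<theta> \<circ>\<^sub>s Var(x := Var y))"
  using assms(3)
proof cases
  case (Dec f ss x ts A n ys S T \<theta>)
  have args: "wf_trm ar (Fun f ss)" "wf_trm ar (Fun f ts)"
    using wf Dec(1) by (simp_all add: wf_aues_insert)
  have "expands ar ab c (arg_aues ss ys ts \<union> A, S, {} \<union> T, \<theta> \<circ>\<^sub>s Var(x := Fun f (map Var ys)))"
    unfolding Dec(1)
    by (rule expands.expand[OF Dec(3,7) _ args]) (use args Dec(4,6) in \<open>auto simp: abs_eq_refl\<close>)
  with Dec(2,6) have "expands ar ab c c'"
    by (simp add: arg_aues_def)
  then show ?thesis
    by (rule expand)
next
  case (Sol s x t A S T \<theta>)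
  then show ?thesis
    by (intro solve)
next
  case (ExpLA1 e x f t1 t2 A y1 y2 S T \<theta>)
  then show ?thesis
    using wf assms(2) absorption_theory_arity[OF assms(1) ExpLA1(4)]
    by (intro expand) (simp add: expands_first wf_aues_insert abs_eq_refl abs_eq_absorb_left)
next
  case (ExpLA2 e x f t1 t2 A y1 y2 S T \<theta>)
  then show ?thesis
    using wf assms(2) absorption_theory_arity[OF assms(1) ExpLA2(4)]
    by (intro expand) (simp add: expands_second wf_aues_insert abs_eq_refl abs_eq_absorb_right)
next
  case (ExpRA1 f s1 s2 x e A y1 y2 S T \<theta>)
  then show ?thesis
    using wf assms(2) absorption_theory_arity[OF assms(1) ExpRA1(4)]
    by (intro expand) (simp add: expands_first wf_aues_insert abs_eq_refl abs_eq_absorb_left)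
next
  case (ExpRA2 f s1 s2 x e A y1 y2 S T \<theta>)
  then show ?thesis
    using wf assms(2) absorption_theory_arity[OF assms(1) ExpRA2(4)]
    by (intro expand) (simp add: expands_second wf_aues_insert abs_eq_refl abs_eq_absorb_right)
next
  case (Mer x y s t S T \<theta>)
  then show ?thesis
    by (intro merge[of s x t "insert (s \<triangleq>\<^bsub>y\<^esub> t) S"]) auto
qed

lemma expands_wf_config:
  assumes "expands ar ab c c'" and "wf_config ar c"
  shows "wf_config ar c'"
  using assms(1)
proof cases
  case (expand s x t A ys S T \<theta> f ss ts N M)
  note fresh = fresh_labels[OF expand(4)]
  have wf_new: "wf_aues ar (N \<union> M)"
    unfolding expand(10) using fresh(1) expand(5-7) by (intro wf_arg_aues) auto
  then have "labels N \<inter> labels M = {}"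
    using inj_on_image_Int[of label "N \<union> M" N M] expand(11) by (simp add: wf_aues_def valid_def)
  moreover have "wf_aues ar N" "wf_aues ar M"
    using wf_new by (auto intro: wf_aues_subset)
  moreover have "labels (N \<union> M) \<inter> labels (A \<union> S \<union> T) = {}"
    using fresh(2) expand(10) by (simp add: labels_arg_aues)
  moreover have "wf_trm ar (Fun f (map Var ys))"
    using expand(5) by simp
  ultimately show ?thesis
    using assms(2) unfolding expand(1,2)
    by (simp add: wf_aues_Un wf_aues_insert wf_subst_comp wf_subst_Var_upd image_Un
        Int_Un_distrib Int_Un_distrib2 Int_commute)
qed

lemma step_wf_config:
  assumes "absorption_theory ar ab" and "ar star = 0"
    and "step ab star c c'" and "wf_config ar c"
  shows "wf_config ar c'"
  using assms
proof (cases rule: step_cases)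
  case expand
  then show ?thesis
    using assms(4) by (rule expands_wf_config)
next
  case (solve u A S T \<theta>)
  then show ?thesis
    using assms(4) by (auto simp: wf_aues_insert)
next
  case (merge s x t y S T \<theta>)
  then show ?thesis
    using assms(4) by (simp add: wf_aues_insert wf_subst_comp wf_subst_Var_upd)
qed


section \<open>Pulling solutions back along the rules\<close>

definition solves ::
  "('f \<Rightarrow> nat) \<Rightarrow> ('f \<rightharpoonup> 'f) \<Rightarrow> ('f, 'v) subst \<Rightarrow> ('f, 'v) subst \<Rightarrow> ('f, 'v) aue set \<Rightarrow> bool" where
  "solves ar ab \<sigma> \<rho> W \<longleftrightarrow>
     (\<forall>u\<in>W. abs_eq ar ab (\<sigma> (label u)) (lhs u) \<and> abs_eq ar ab (\<rho> (label u)) (rhs u))"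

lemma solves_lhs_rhs_subst:
  assumes "wf_aues ar W"
  shows "solves ar ab (lhs_subst W) (rhs_subst W) W"
  using assms by (simp add: solves_def wf_aues_def lhs_subst_label rhs_subst_label abs_eq_refl)

definition pulls_back :: "('f \<Rightarrow> nat) \<Rightarrow> ('f \<rightharpoonup> 'f) \<Rightarrow> ('f, 'v) config \<Rightarrow> ('f, 'v) config \<Rightarrow> bool" where
  "pulls_back ar ab c c' \<longleftrightarrow>
     (\<exists>\<delta>. config_subst c' = config_subst c \<circ>\<^sub>s \<delta> \<and>
       (\<forall>\<sigma> \<rho>. solves ar ab \<sigma> \<rho> (aues c') \<longrightarrow> solves ar ab (\<delta> \<circ>\<^sub>s \<sigma>) (\<delta> \<circ>\<^sub>s \<rho>) (aues c)))"

lemma pulls_back_same: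
  assumes "config_subst c' = config_subst c" and "aues c' = aues c"
  shows "pulls_back ar ab c c'"
  unfolding pulls_back_def using assms
  by (intro exI[of _ Var]) (simp add: subst_comp_Var Var_subst_comp)

lemma pulls_back_trans:
  assumes "pulls_back ar ab c c'" and "pulls_back ar ab c' c''"
  shows "pulls_back ar ab c c''"
  using assms unfolding pulls_back_def by (metis subst_comp_assoc)

lemma pulls_back_upd:
  assumes "config_subst c' = config_subst c \<circ>\<^sub>s Var(x := r)"
    and "aues c = insert (s \<triangleq>\<^bsub>x\<^esub> t) V" and "x \<notin> labels V" and "V \<subseteq> aues c'"
    and solved: "\<And>\<sigma> \<rho>. solves ar ab \<sigma> \<rho> (aues c') \<Longrightarrow>
      abs_eq ar ab (r \<cdot> \<sigma>) s \<and> abs_eq ar ab (r \<cdot> \<rho>) t"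
  shows "pulls_back ar ab c c'"
proof -
  have "solves ar ab (Var(x := r) \<circ>\<^sub>s \<sigma>) (Var(x := r) \<circ>\<^sub>s \<rho>) (aues c)"
    if solves: "solves ar ab \<sigma> \<rho> (aues c')" for \<sigma> \<rho>
    unfolding solves_def
  proof
    fix u
    assume "u \<in> aues c"
    then consider (replaced) "u = (s \<triangleq>\<^bsub>x\<^esub> t)" | (kept) "u \<in> V" "label u \<noteq> x"
      using assms(2,3) by auto
    then show "abs_eq ar ab ((Var(x := r) \<circ>\<^sub>s \<sigma>) (label u)) (lhs u) \<and>
      abs_eq ar ab ((Var(x := r) \<circ>\<^sub>s \<rho>) (label u)) (rhs u)"
    proof cases
      case replaced
      then show ?thesis
        using solved[OF solves] by (simp add: subst_comp_def)
    next
      case kept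
      then show ?thesis
        using solves assms(4) by (auto simp: subst_comp_def solves_def)
    qed
  qed
  then show ?thesis
    using assms(1) unfolding pulls_back_def by blast
qed

lemma expands_pulls_back:
  assumes "expands ar ab c c'" and "wf_config ar c"
  shows "pulls_back ar ab c c'"
  using assms(1)
proof cases
  case (expand s x t A ys S T \<theta> f ss ts N M)
  let ?r = "Fun f (map Var ys)"
  have "x \<notin> labels (A \<union> S \<union> T)"
    using wf_config_label_notin[OF assms(2)[unfolded expand(1)] expand(3)] by simp
  moreover have "abs_eq ar ab (?r \<cdot> \<sigma>) s \<and> abs_eq ar ab (?r \<cdot> \<rho>) t"
    if "solves ar ab \<sigma> \<rho> (aues c')" for \<sigma> \<rho>
  proof -
    have "arg_aues ss ys ts \<subseteq> aues c'"
      using expand(2,10) by auto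
    then have "list_all2 (abs_eq ar ab) (map \<sigma> ys) ss" "list_all2 (abs_eq ar ab) (map \<rho> ys) ts"
      using that expand(5-7) by (force simp: solves_def arg_aues_def list_all2_conv_all_nth)+
    then have "abs_eq ar ab (?r \<cdot> \<sigma>) (Fun f ss)" "abs_eq ar ab (?r \<cdot> \<rho>) (Fun f ts)"
      using expand(5) by (simp_all add: abs_eq_cong comp_def)
    then show ?thesis
      using expand(8,9) by (blast intro: abs_eq_trans)
  qed
  ultimately show ?thesis
    using expand(1,2) by (intro pulls_back_upd[where V = "A \<union> S \<union> T" and x = x]) auto
qed

lemma step_pulls_back:
  assumes "absorption_theory ar ab" and "ar star = 0"
    and "step ab star c c'" and "wf_config ar c"
  shows "pulls_back ar ab c c'"
  using assms
proof (cases rule: step_cases)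
  case expand
  then show ?thesis
    using assms(4) by (rule expands_pulls_back)
next
  case (solve u A S T \<theta>)
  then show ?thesis
    by (intro pulls_back_same) auto
next
  case (merge s x t y S T \<theta>)
  have "x \<notin> labels (S \<union> T)"
    using merge(1,2) assms(4) by (auto simp: wf_aues_insert)
  with merge show ?thesis
    by (intro pulls_back_upd[where V = "S \<union> T" and x = x and r = "Var y"]) (force simp: solves_def)+
qed

lemma derivation_wf_config_pulls_back:
  assumes "absorption_theory ar ab" and "ar star = 0" and "derivation ar ab star c c'"
  shows "wf_config ar c' \<and> pulls_back ar ab c c'"
proof -
  from assms(3) have "(step ab star)\<^sup>*\<^sup>* c c'" and "wf_config ar c"
    by (auto simp: derivation_def intro: configuration_imp_wf_config)
  then show ?thesis
  proof (induction rule: rtranclp_induct)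
    case base
    then show ?case
      by (simp add: pulls_back_same)
  next
    case (step c' c'')
    then show ?case
      using step_wf_config[OF assms(1,2)] step_pulls_back[OF assms(1,2)] pulls_back_trans by metis
  qed
qed

lemma derivation_sound:
  assumes "absorption_theory ar ab" and "ar star = 0" and "derivation ar ab star c c'"
    and "u \<in> aues c" and "solves ar ab \<sigma> \<rho> (aues c')"
  shows "abs_eq ar ab (config_subst c' (label u) \<cdot> \<sigma>) (lhs u)"
    and "abs_eq ar ab (config_subst c' (label u) \<cdot> \<rho>) (rhs u)"
proof -
  obtain \<delta> where subst: "config_subst c' = config_subst c \<circ>\<^sub>s \<delta>"
    and "solves ar ab (\<delta> \<circ>\<^sub>s \<sigma>) (\<delta> \<circ>\<^sub>s \<rho>) (aues c)"
    using derivation_wf_config_pulls_back[OF assms(1-3)] assms(5) unfolding pulls_back_def by blast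
  then have "abs_eq ar ab (\<delta> (label u) \<cdot> \<sigma>) (lhs u)" "abs_eq ar ab (\<delta> (label u) \<cdot> \<rho>) (rhs u)"
    using assms(4) by (simp_all add: solves_def subst_comp_def)
  moreover have "config_subst c (label u) = Var (label u)"
    using assms(3,4) by (auto simp: derivation_def intro: configuration_subst_label)
  then have "config_subst c' (label u) = \<delta> (label u)"
    by (simp add: subst subst_comp_def)
  ultimately show "abs_eq ar ab (config_subst c' (label u) \<cdot> \<sigma>) (lhs u)"
    "abs_eq ar ab (config_subst c' (label u) \<cdot> \<rho>) (rhs u)"
    by simp_all
qed

theorem theorem2:
  fixes ar :: "'f \<Rightarrow> nat"
    and ab :: "'f \<rightharpoonup> 'f"
    and star :: 'f
    and A\<^sub>0 S\<^sub>0 T\<^sub>0 S\<^sub>n T\<^sub>n :: "('f, 'v) aue set"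
    and \<theta>\<^sub>0 \<theta>\<^sub>n :: "('f, 'v) subst"
  assumes "absorption_theory ar ab"
    and "ar star = 0"
    and "derivation ar ab star (A\<^sub>0, S\<^sub>0, T\<^sub>0, \<theta>\<^sub>0) ({}, S\<^sub>n, T\<^sub>n, \<theta>\<^sub>n)"
    and "final ab star ({}, S\<^sub>n, T\<^sub>n, \<theta>\<^sub>n)"
  shows "\<forall>s x t. (s \<triangleq>\<^bsub>x\<^esub> t) \<in> A\<^sub>0 \<union> S\<^sub>0 \<union> T\<^sub>0 \<longrightarrow>
    Var x \<cdot> \<theta>\<^sub>n \<in> generalizations ar ab s t \<and>
    abs_eq ar ab (Var x \<cdot> \<theta>\<^sub>n \<cdot> lhs_subst (S\<^sub>n \<union> T\<^sub>n)) s \<and>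
    abs_eq ar ab (Var x \<cdot> \<theta>\<^sub>n \<cdot> rhs_subst (S\<^sub>n \<union> T\<^sub>n)) t"
proof (intro allI impI)
  fix s x t
  assume member: "(s \<triangleq>\<^bsub>x\<^esub> t) \<in> A\<^sub>0 \<union> S\<^sub>0 \<union> T\<^sub>0"
  let ?\<sigma> = "lhs_subst (S\<^sub>n \<union> T\<^sub>n)" and ?\<rho> = "rhs_subst (S\<^sub>n \<union> T\<^sub>n)"
  have wf_config: "wf_config ar ({}, S\<^sub>n, T\<^sub>n, \<theta>\<^sub>n)"
    using derivation_wf_config_pulls_back[OF assms(1-3)] ..
  then have "wf_trm ar (\<theta>\<^sub>n x)" and wf_aues: "wf_aues ar (S\<^sub>n \<union> T\<^sub>n)"
    using wf_config_imp_wf_aues[OF wf_config] by (simp_all add: wf_subst_def)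
  moreover have "solves ar ab ?\<sigma> ?\<rho> (aues ({}, S\<^sub>n, T\<^sub>n, \<theta>\<^sub>n))"
    using solves_lhs_rhs_subst[OF wf_aues] by simp
  then have "abs_eq ar ab (\<theta>\<^sub>n x \<cdot> ?\<sigma>) s" "abs_eq ar ab (\<theta>\<^sub>n x \<cdot> ?\<rho>) t"
    using derivation_sound[OF assms(1-3), of "s \<triangleq>\<^bsub>x\<^esub> t"] member by simp_all
  ultimately show "Var x \<cdot> \<theta>\<^sub>n \<in> generalizations ar ab s t \<and>
    abs_eq ar ab (Var x \<cdot> \<theta>\<^sub>n \<cdot> ?\<sigma>) s \<and> abs_eq ar ab (Var x \<cdot> \<theta>\<^sub>n \<cdot> ?\<rho>) t"
    using wf_lhs_subst[OF wf_aues] wf_rhs_subst[OF wf_aues] generalizationsI by simp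
qed

end
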